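(* Let $\mathcal{E}_{\mathtt{RS}} = \mathcal{E}_1 \cup \{\mathrm{RS}, \mathrm{RSP1}, \mathrm{RSP2}, \mathrm{EL2}\}$ (axioms listed in the context). For all closed $\mathrm{BCCSP}_{\|}$ terms $p,q$: if $p \sim_{\mathtt{RS}} q$ then $\mathcal{E}_{\mathtt{RS}} \vdash p \approx q$.
   Context: Let $\mathcal{A}$ be a finite non-empty set of actions and $\mathcal{V}$ a countably infinite set of variables. $\mathrm{BCCSP}_{\|}$ terms are generated by $t ::= \mathbf{0} \mid x \mid a.t \mid t+t \mid t \,\|\, t$ with $a\in\mathcal{A}$, $x \in \mathcal{V}$ (prefixing binds strongest, $+$ weakest; trailing $\mathbf{0}$ omitted, $ax$ means $a.x$). Closed terms (no variables) are called processes. The transition relation on processes is the least relation with: $a.p \xrightarrow{a} p$; if $p \xrightarrow{a} p'$ then $p+q \xrightarrow{a} p'$, $q+p \xrightarrow{a} p'$, $p\|q \xrightarrow{a} p'\|q$ and $q \| p \xrightarrow{a} q \| p'$. Let $\mathtt{I}(p)=\{a \mid p \xrightarrow{a} p' \text{ for some } p'\}$. A simulation is a relation $R$ on processes such that whenever $p R q$ and $p\xrightarrow{a}p'$ there is $q'$ with $q \xrightarrow{a} q'$ and $p' R q'$; a ready simulation is a simulation $R$ such that $pRq$ implies $\mathtt{I}(p)=\mathtt{I}(q)$. $p \sqsubseteq_{\mathtt{RS}} q$ iff $pRq$ for some ready simulation $R$, and $p\sim_{\mathtt{RS}} q$ iff $p \sqsubseteq_{\mathtt{RS}} q$ and $q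 \sqsubseteq_{\mathtt{RS}} p$. For a set $\mathcal{E}$ of equations, $\mathcal{E}\vdash t \approx u$ means $t\approx u$ is derivable using reflexivity, symmetry, transitivity, substitution instances of equations in $\mathcal{E}$, and closure under $a.\_$, $+$ and $\|$. Axioms containing concrete action names stand for all their instances with actions from $\mathcal{A}$; $\sum_{i\in I} t_i$ denotes a finite sum ($\mathbf{0}$ if $I=\emptyset$). $\mathcal{E}_1$ consists of: A0 $x+\mathbf{0}\approx x$; A1 $x+y\approx y+x$; A2 $(x+y)+z \approx x+(y+z)$; A3 $x+x\approx x$; P0 $x\|\mathbf{0}\approx x$; P1 $x\|y \approx y \| x$. RS: $a(bx+by+z)\approx a(bx+by+z)+a(bx+z)$. RSP1: $(ax+ay+u)\|(bz+bw+v) \approx (ax+u)\|(bz+bw+v) + (ay+u)\|(bz+bw+v) + (ax+ay+u)\|(bz+v) + (ax+ay+u)\|(bw+v)$. RSP2: $(\sum_{i\in I} a_i x_i)\|(by+bz+w) \approx (\sum_{i\in I} a_ix_i)\|(by+w) + (\sum_{i\in I} a_ix_i)\|(bz+w) + \sum_{i\in I} a_i(x_i \| (by+bz+w))$, where $I$ is finite and $a_j\neq a_k$ for $j \neq k$. EL2: $\sum_{i\in I} a_ix_i \| \sum_{j\in J} b_jy_j \approx \sum_{i\in I} a_i(x_i \| \sum_{j\in J} b_j y_j) + \sum_{j\in J} b_j(\sum_{i\in I} a_i x_i \| y_j)$, where $I,J$ finite, the $a_i$ pairwise distinct and the $b_j$ pairwise distinct. *)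

theory Defs
  imports Main
begin

text \<open>The finite non-empty set of actions is a type of class \<open>finite\<close> (it is only needed where
  finiteness matters, i.e. in the theorem); the countably infinite set of variables is \<open>nat\<close>.\<close>

datatype 'a bccsp =
    Zero  (\<open>\<zero>\<close>)
  | Var nat
  | Pre 'a "'a bccsp"  (infixr \<open>\<cdot>\<close> 80)
  | Plus "'a bccsp" "'a bccsp"  (infixl \<open>\<oplus>\<close> 65)
  | Par "'a bccsp" "'a bccsp"  (infixl \<open>\<parallel>\<close> 70)

primrec vars :: "'a bccsp \<Rightarrow> nat set" where
  "vars \<zero> = {}"
| "vars (Var x) = {x}"
| "vars (a \<cdot> t) = vars t"
| "vars (t \<oplus> u) = vars t \<union> vars u"
| "vars (t \<parallel> u) = vars t \<union> vars u"

definition processes :: "'a bccsp set" where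
  "processes = {p. vars p = {}}"

text \<open>The rules are stated for all terms. Subterms of closed terms are closed and no rule has a
  transition from a variable, so on processes this is the transition relation of processes.\<close>

inductive step :: "'a bccsp \<Rightarrow> 'a \<Rightarrow> 'a bccsp \<Rightarrow> bool" where
  pre: "step (a \<cdot> p) a p"
| plusL: "step p a p' \<Longrightarrow> step (p \<oplus> q) a p'"
| plusR: "step p a p' \<Longrightarrow> step (q \<oplus> p) a p'"
| parL: "step p a p' \<Longrightarrow> step (p \<parallel> q) a (p' \<parallel> q)"
| parR: "step p a p' \<Longrightarrow> step (q \<parallel> p) a (q \<parallel> p')"

definition initials :: "'a bccsp \<Rightarrow> 'a set" where
  "initials p = {a. \<exists>p'. step p a p'}"

definition simulation :: "('a bccsp \<times> 'a bccsp) set \<Rightarrow> bool" where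
  "simulation R \<longleftrightarrow> R \<subseteq> processes \<times> processes \<and>
     (\<forall>p q a p'. (p, q) \<in> R \<longrightarrow> step p a p' \<longrightarrow> (\<exists>q'. step q a q' \<and> (p', q') \<in> R))"

definition ready_simulation :: "('a bccsp \<times> 'a bccsp) set \<Rightarrow> bool" where
  "ready_simulation R \<longleftrightarrow> simulation R \<and> (\<forall>p q. (p, q) \<in> R \<longrightarrow> initials p = initials q)"

definition rs_le :: "'a bccsp \<Rightarrow> 'a bccsp \<Rightarrow> bool"  (infix \<open>\<sqsubseteq>\<^sub>R\<^sub>S\<close> 50) where
  "p \<sqsubseteq>\<^sub>R\<^sub>S q \<longleftrightarrow> (\<exists>R. ready_simulation R \<and> (p, q) \<in> R)"

definition rs_equiv :: "'a bccsp \<Rightarrow> 'a bccsp \<Rightarrow> bool"  (infix \<open>\<sim>\<^sub>R\<^sub>S\<close> 50) where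
  "p \<sim>\<^sub>R\<^sub>S q \<longleftrightarrow> p \<sqsubseteq>\<^sub>R\<^sub>S q \<and> q \<sqsubseteq>\<^sub>R\<^sub>S p"

primrec subst :: "(nat \<Rightarrow> 'a bccsp) \<Rightarrow> 'a bccsp \<Rightarrow> 'a bccsp" where
  "subst \<sigma> \<zero> = \<zero>"
| "subst \<sigma> (Var x) = \<sigma> x"
| "subst \<sigma> (a \<cdot> t) = a \<cdot> subst \<sigma> t"
| "subst \<sigma> (t \<oplus> u) = subst \<sigma> t \<oplus> subst \<sigma> u"
| "subst \<sigma> (t \<parallel> u) = subst \<sigma> t \<parallel> subst \<sigma> u"

type_synonym 'a equation = "'a bccsp \<times> 'a bccsp"

inductive derivable :: "'a equation set \<Rightarrow> 'a bccsp \<Rightarrow> 'a bccsp \<Rightarrow> bool"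
    (\<open>_ \<turnstile> _ \<approx> _\<close> [51, 51, 51] 50)
  for E :: "'a equation set" where
  refl: "E \<turnstile> t \<approx> t"
| sym: "E \<turnstile> t \<approx> u \<Longrightarrow> E \<turnstile> u \<approx> t"
| trans: "E \<turnstile> t \<approx> u \<Longrightarrow> E \<turnstile> u \<approx> v \<Longrightarrow> E \<turnstile> t \<approx> v"
| inst: "(t, u) \<in> E \<Longrightarrow> E \<turnstile> subst \<sigma> t \<approx> subst \<sigma> u"
| pre: "E \<turnstile> t \<approx> u \<Longrightarrow> E \<turnstile> a \<cdot> t \<approx> a \<cdot> u"
| plus: "E \<turnstile> t \<approx> u \<Longrightarrow> E \<turnstile> t' \<approx> u' \<Longrightarrow> E \<turnstile> t \<oplus> t' \<approx> u \<oplus> u'"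
| par: "E \<turnstile> t \<approx> u \<Longrightarrow> E \<turnstile> t' \<approx> u' \<Longrightarrow> E \<turnstile> t \<parallel> t' \<approx> u \<parallel> u'"

text \<open>\<open>bsum n t\<close> is the sum of the \<open>t i\<close> over the index set \<open>{..<n}\<close>, associated to the left;
  a one-element sum is its summand, without an added \<open>\<zero>\<close>.\<close>

fun bsum :: "nat \<Rightarrow> (nat \<Rightarrow> 'a bccsp) \<Rightarrow> 'a bccsp" where
  "bsum 0 t = \<zero>"
| "bsum (Suc 0) t = t 0"
| "bsum (Suc (Suc n)) t = bsum (Suc n) t \<oplus> t (Suc n)"

text \<open>Pairwise distinct variables in which the axioms are written.\<close>

abbreviation "X \<equiv> Var 0"
abbreviation "Y \<equiv> Var 1"
abbreviation "Z \<equiv> Var 2"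
abbreviation "U \<equiv> Var 3"
abbreviation "V \<equiv> Var 4"
abbreviation "W \<equiv> Var 5"
abbreviation "XI i \<equiv> Var (6 + 2 * i)"
abbreviation "YI j \<equiv> Var (7 + 2 * j)"

definition E1 :: "'a equation set" where
  "E1 =
    {(X \<oplus> \<zero>, X),
     (X \<oplus> Y, Y \<oplus> X),
     ((X \<oplus> Y) \<oplus> Z, X \<oplus> (Y \<oplus> Z)),
     (X \<oplus> X, X),
     (X \<parallel> \<zero>, X),
     (X \<parallel> Y, Y \<parallel> X)}"

definition RS :: "'a equation set" where
  "RS = {(a \<cdot> (b \<cdot> X \<oplus> b \<cdot> Y \<oplus> Z),
          a \<cdot> (b \<cdot> X \<oplus> b \<cdot> Y \<oplus> Z) \<oplus> a \<cdot> (b \<cdot> X \<oplus> Z)) | a b. True}"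

definition RSP1 :: "'a equation set" where
  "RSP1 = {((a \<cdot> X \<oplus> a \<cdot> Y \<oplus> U) \<parallel> (b \<cdot> Z \<oplus> b \<cdot> W \<oplus> V),
            (a \<cdot> X \<oplus> U) \<parallel> (b \<cdot> Z \<oplus> b \<cdot> W \<oplus> V)
            \<oplus> (a \<cdot> Y \<oplus> U) \<parallel> (b \<cdot> Z \<oplus> b \<cdot> W \<oplus> V)
            \<oplus> (a \<cdot> X \<oplus> a \<cdot> Y \<oplus> U) \<parallel> (b \<cdot> Z \<oplus> V)
            \<oplus> (a \<cdot> X \<oplus> a \<cdot> Y \<oplus> U) \<parallel> (b \<cdot> W \<oplus> V)) | a b. True}"

definition RSP2 :: "'a equation set" where
  "RSP2 = {(bsum n (\<lambda>i. a i \<cdot> XI i) \<parallel> (b \<cdot> Y \<oplus> b \<cdot> Z \<oplus> W),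
            bsum n (\<lambda>i. a i \<cdot> XI i) \<parallel> (b \<cdot> Y \<oplus> W)
            \<oplus> bsum n (\<lambda>i. a i \<cdot> XI i) \<parallel> (b \<cdot> Z \<oplus> W)
            \<oplus> bsum n (\<lambda>i. a i \<cdot> (XI i \<parallel> (b \<cdot> Y \<oplus> b \<cdot> Z \<oplus> W))))
           | n a b. inj_on a {..<n}}"

definition EL2 :: "'a equation set" where
  "EL2 = {(bsum n (\<lambda>i. a i \<cdot> XI i) \<parallel> bsum m (\<lambda>j. b j \<cdot> YI j),
           bsum n (\<lambda>i. a i \<cdot> (XI i \<parallel> bsum m (\<lambda>j. b j \<cdot> YI j)))
           \<oplus> bsum m (\<lambda>j. b j \<cdot> (bsum n (\<lambda>i. a i \<cdot> XI i) \<parallel> YI j)))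
          | n a m b. inj_on a {..<n} \<and> inj_on b {..<m}}"

definition ERS :: "'a equation set" where
  "ERS = E1 \<union> RS \<union> RSP1 \<union> RSP2 \<union> EL2"

end

theory Submission
  imports Defs
begin

text \<open>Derivability of \<open>t \<approx> t \<oplus> s\<close> is a preorder in \<open>s\<close> and \<open>t\<close> whose joins are sums, and it suffices to
  show that \<open>p \<sqsubseteq>\<^sub>R\<^sub>S q\<close> implies that \<open>p\<close> lies below \<open>q\<close> in it. The expansion axioms turn every process
  into a sum of prefixes that is ready simulated by it, and they show that \<open>a \<cdot> p'\<close> lies
  below \<open>p\<close> whenever \<open>p\<close> has an \<open>a\<close>-transition to \<open>p'\<close>. Given a summand \<open>a \<cdot> x\<close> of \<open>p\<close>, some
  \<open>a\<close>-derivative \<open>q'\<close> of \<open>q\<close> ready simulates \<open>x\<close>; by induction on \<open>q\<close>, \<open>a \<cdot> q' \<approx> a \<cdot> (q' \<oplus> x)\<close>. As \<open>x\<close>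
  and \<open>q'\<close> have the same initials, RS removes the summands of \<open>q'\<close> one by one, leaving \<open>a \<cdot> x\<close>.\<close>

section \<open>The preorder of derivable absorption\<close>

text \<open>Monotone under sums by construction, but not under prefixing: a plain
  \<open>\<preceq>\<close> passes through a prefix only under the extra hypotheses of
  \<open>pre_below\<close>, whereas equations do so through \<open>pre_cong_below\<close>.\<close>

definition below :: "'a bccsp \<Rightarrow> 'a bccsp \<Rightarrow> bool"  (infix \<open>\<preceq>\<close> 50) where
  "s \<preceq> t \<longleftrightarrow> ERS \<turnstile> t \<approx> t \<oplus> s"

abbreviation eq_ERS :: "'a bccsp \<Rightarrow> 'a bccsp \<Rightarrow> bool"  (infix \<open>\<simeq>\<close> 50) where
  "s \<simeq> t \<equiv> ERS \<turnstile> s \<approx> t"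

lemmas eq_sym = derivable.sym[where E = ERS]
lemmas eq_trans [trans] = derivable.trans[where E = ERS]

text \<open>The list gives the values of \<open>X\<close>, \<open>Y\<close>, \<open>Z\<close>,
  \<open>U\<close>, \<open>V\<close>, \<open>W\<close> in the order of their numbers 0 to 5.\<close>

definition env :: "'a bccsp list \<Rightarrow> nat \<Rightarrow> 'a bccsp" where
  "env ts i = (if i < length ts then ts ! i else \<zero>)"

lemma
  shows A0: "t \<oplus> \<zero> \<simeq> t"
    and A1: "t \<oplus> u \<simeq> u \<oplus> t"
    and A2: "(t \<oplus> u) \<oplus> v \<simeq> t \<oplus> (u \<oplus> v)"
    and A3: "t \<oplus> t \<simeq> t"
    and P1: "t \<parallel> u \<simeq> u \<parallel> t"
  using derivable.inst[of "X \<oplus> \<zero>" "X" ERS "env [t, u, v]"]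
    derivable.inst[of "X \<oplus> Y" "Y \<oplus> X" ERS "env [t, u, v]"]
    derivable.inst[of "(X \<oplus> Y) \<oplus> Z" "X \<oplus> (Y \<oplus> Z)" ERS "env [t, u, v]"]
    derivable.inst[of "X \<oplus> X" "X" ERS "env [t, u, v]"]
    derivable.inst[of "X \<parallel> Y" "Y \<parallel> X" ERS "env [t, u, v]"]
  by (simp_all add: ERS_def E1_def env_def)

lemma par_cong: "t \<simeq> t' \<Longrightarrow> u \<simeq> u' \<Longrightarrow> t \<parallel> u \<simeq> t' \<parallel> u'"
  and plus_cong: "t \<simeq> t' \<Longrightarrow> u \<simeq> u' \<Longrightarrow> t \<oplus> u \<simeq> t' \<oplus> u'"
  by (auto intro: derivable.par derivable.plus)

lemmas plus_congL = plus_cong[OF _ derivable.refl]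
lemmas plus_congR = plus_cong[OF derivable.refl]

lemma below_trans [trans]:
  assumes "s \<preceq> t" "t \<preceq> u"
  shows "s \<preceq> u"
proof -
  have "u \<simeq> u \<oplus> t" using assms by (simp add: below_def)
  also have "\<dots> \<simeq> u \<oplus> (t \<oplus> s)" using assms by (intro plus_congR) (simp add: below_def)
  also have "\<dots> \<simeq> (u \<oplus> t) \<oplus> s" by (rule eq_sym[OF A2])
  also have "\<dots> \<simeq> u \<oplus> s" using assms by (intro plus_congL eq_sym[of u]) (simp add: below_def)
  finally show ?thesis by (simp add: below_def)
qed

lemma eq_imp_below:
  assumes "s \<simeq> t"
  shows "s \<preceq> t"
proof -
  have "t \<simeq> t \<oplus> t" by (rule eq_sym[OF A3])
  also have "\<dots> \<simeq> t \<oplus> s" by (intro plus_congR eq_sym[OF assms])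
  finally show ?thesis by (simp add: below_def)
qed

lemma below_refl [simp]: "t \<preceq> t"
  by (simp add: eq_imp_below derivable.refl)

lemma eq_iff_below: "s \<simeq> t \<longleftrightarrow> s \<preceq> t \<and> t \<preceq> s"
proof
  assume *: "s \<preceq> t \<and> t \<preceq> s"
  then have "s \<simeq> s \<oplus> t" by (simp add: below_def)
  also have "\<dots> \<simeq> t \<oplus> s" by (rule A1)
  also have "\<dots> \<simeq> t" using * by (intro eq_sym[of t]) (simp add: below_def)
  finally show "s \<simeq> t" .
qed (auto intro: eq_imp_below eq_sym)

lemma below_plusL: "s \<preceq> t \<Longrightarrow> s \<preceq> t \<oplus> u"
  and below_plusR: "s \<preceq> u \<Longrightarrow> s \<preceq> t \<oplus> u"
proof -
  have l: "t \<preceq> t \<oplus> u" for t u :: "'a bccsp"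
  proof -
    have "t \<oplus> u \<simeq> (t \<oplus> t) \<oplus> u" by (rule plus_congL[OF eq_sym[OF A3]])
    also have "\<dots> \<simeq> t \<oplus> (t \<oplus> u)" by (rule A2)
    also have "\<dots> \<simeq> (t \<oplus> u) \<oplus> t" by (rule A1)
    finally show ?thesis by (simp add: below_def)
  qed
  have r: "u \<preceq> t \<oplus> u"
    using l[of u t] eq_imp_below[OF A1] below_trans by blast
  show "s \<preceq> t \<Longrightarrow> s \<preceq> t \<oplus> u" "s \<preceq> u \<Longrightarrow> s \<preceq> t \<oplus> u"
    using l r below_trans by blast+
qed

lemma plus_below_iff [simp]: "s \<oplus> s' \<preceq> t \<longleftrightarrow> s \<preceq> t \<and> s' \<preceq> t"
proof
  assume *: "s \<preceq> t \<and> s' \<preceq> t"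
  then have "t \<simeq> t \<oplus> s'" by (simp add: below_def)
  also have "\<dots> \<simeq> (t \<oplus> s) \<oplus> s'" using * by (intro plus_congL) (simp add: below_def)
  also have "\<dots> \<simeq> t \<oplus> (s \<oplus> s')" by (rule A2)
  finally show "s \<oplus> s' \<preceq> t" by (simp add: below_def)
next
  assume "s \<oplus> s' \<preceq> t"
  then show "s \<preceq> t \<and> s' \<preceq> t"
    using below_plusL[OF below_refl] below_plusR[OF below_refl] below_trans by blast
qed

lemma zero_below [simp]: "\<zero> \<preceq> t"
  unfolding below_def by (rule eq_sym[OF A0])

lemma absorb_eq: "s \<preceq> t \<Longrightarrow> t \<simeq> s \<oplus> t"
  by (rule eq_trans[OF _ A1]) (simp add: below_def)

lemma pre_cong_below: "t \<simeq> u \<Longrightarrow> a \<cdot> t \<preceq> a \<cdot> u"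
  by (intro eq_imp_below derivable.pre)

section \<open>Sums of prefixes\<close>

text \<open>Lists of pairs replace the indexed sums of the axioms: they are easy to reorder and
  shorten. Unlike \<open>bsum\<close>, this sum always ends in \<open>\<zero>\<close>, which gives a
  uniform induction; A0 absorbs the difference.\<close>

primrec psum :: "('a \<times> 'a bccsp) list \<Rightarrow> 'a bccsp" where
  "psum [] = \<zero>"
| "psum (s # P) = fst s \<cdot> snd s \<oplus> psum P"

lemma psum_below_iff [simp]: "psum P \<preceq> t \<longleftrightarrow> (\<forall>(a, x) \<in> set P. a \<cdot> x \<preceq> t)"
  by (induction P) auto

lemma summand_below: "(a, x) \<in> set P \<Longrightarrow> a \<cdot> x \<preceq> psum P"
  by (induction P) (auto intro: below_plusL below_plusR)

text \<open>By A0 to A3 order and multiplicity of summands are irrelevant. This later allows two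
  summands with a common action to be moved to the front.\<close>

lemma psum_set_cong: "set P = set Q \<Longrightarrow> psum P \<simeq> psum Q"
  by (auto simp: eq_iff_below intro: summand_below)

section \<open>Transitions and initials of sums and parallel compositions\<close>

lemma step_simps [simp]:
  "\<not> step \<zero> a t"
  "\<not> step (Var i) a t"
  "step (b \<cdot> t) a t' \<longleftrightarrow> b = a \<and> t' = t"
  "step (t \<oplus> u) a t' \<longleftrightarrow> step t a t' \<or> step u a t'"
  by (auto elim: step.cases intro: step.intros)

lemma step_par_iff:
  "step (t \<parallel> u) a v \<longleftrightarrow> (\<exists>t'. step t a t' \<and> v = t' \<parallel> u) \<or> (\<exists>u'. step u a u' \<and> v = t \<parallel> u')"
  by (auto elim: step.cases intro: step.intros)

lemma step_psum [simp]: "step (psum P) a x \<longleftrightarrow> (a, x) \<in> set P"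
  by (induction P) auto

lemma vars_psum: "vars (psum P) = (\<Union>(a, x) \<in> set P. vars x)"
  by (induction P) auto

lemma initials_psum: "initials (psum P) = fst ` set P"
  by (force simp: initials_def)

lemma initials_plus [simp]: "initials (t \<oplus> u) = initials t \<union> initials u"
  by (auto simp: initials_def)

lemma initials_par [simp]: "initials (t \<parallel> u) = initials t \<union> initials u"
  by (auto simp: initials_def step_par_iff)

section \<open>From indexed sums to lists of summands\<close>

lemma bsum_subst: "subst \<sigma> (bsum n t) = bsum n (\<lambda>i. subst \<sigma> (t i))"
  by (induction n t rule: bsum.induct) auto

lemma bsum_cong: "(\<And>i. i < n \<Longrightarrow> t i = u i) \<Longrightarrow> bsum n t = bsum n u"
  by (induction n t rule: bsum.induct) auto

lemma bsum_eq_cong: "(\<And>i. t i \<simeq> u i) \<Longrightarrow> bsum n t \<simeq> bsum n u"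
  by (induction n t rule: bsum.induct) (auto intro: derivable.intros)

lemma bsum_below_iff: "bsum n t \<preceq> u \<longleftrightarrow> (\<forall>i<n. t i \<preceq> u)"
  by (induction n t rule: bsum.induct) (auto simp: less_Suc_eq)

text \<open>Both sums have the same summands, so each is below the other. That a summand is below
  the indexed sum is reflexivity of \<open>\<preceq>\<close> read through
  \<open>bsum_below_iff\<close>.\<close>

lemma bsum_psum: "bsum (length P) (\<lambda>i. fst (P ! i) \<cdot> snd (P ! i)) \<simeq> psum P"
proof -
  let ?b = "bsum (length P) (\<lambda>i. fst (P ! i) \<cdot> snd (P ! i))"
  have "a \<cdot> x \<preceq> ?b" if "(a, x) \<in> set P" for a x
  proof -
    obtain i where "i < length P" "P ! i = (a, x)" using \<open>(a, x) \<in> set P\<close> by (auto simp: in_set_conv_nth)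
    then show ?thesis
      using bsum_below_iff[THEN iffD1, OF below_refl, of "length P" "\<lambda>i. fst (P ! i) \<cdot> snd (P ! i)"] by force
  qed
  then show ?thesis
    by (auto simp: eq_iff_below bsum_below_iff intro: summand_below)
qed

text \<open>Inverts the numbering of the axiom variables: numbers below 6 are \<open>X\<close> to
  \<open>W\<close>, even numbers from 6 on are the \<open>XI i\<close>, odd numbers from 7 on the
  \<open>YI j\<close>.\<close>

definition env2 :: "'a bccsp list \<Rightarrow> 'a bccsp list \<Rightarrow> 'a bccsp list \<Rightarrow> nat \<Rightarrow> 'a bccsp" where
  "env2 ts us vs k = (if k < 6 then ts ! k else if even k then us ! ((k - 6) div 2) else vs ! ((k - 7) div 2))"

abbreviation parL_summands :: "('a \<times> 'a bccsp) list \<Rightarrow> 'a bccsp \<Rightarrow> ('a \<times> 'a bccsp) list" where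
  "parL_summands P u \<equiv> map (\<lambda>(a, x). (a, x \<parallel> u)) P"

abbreviation parR_summands :: "'a bccsp \<Rightarrow> ('a \<times> 'a bccsp) list \<Rightarrow> ('a \<times> 'a bccsp) list" where
  "parR_summands t Q \<equiv> map (\<lambda>(b, y). (b, t \<parallel> y)) Q"

lemma bsum_map:
  assumes "\<And>a x. g (a, x) = (a, f x)"
  shows "bsum (length P) (\<lambda>i. fst (P ! i) \<cdot> f (snd (P ! i))) \<simeq> psum (map g P)"
proof -
  have g: "g s = (fst s, f (snd s))" for s
    using assms[of "fst s" "snd s"] by simp
  have "bsum (length P) (\<lambda>i. fst (P ! i) \<cdot> f (snd (P ! i)))
      = bsum (length P) (\<lambda>i. fst (map g P ! i) \<cdot> snd (map g P ! i))"
    by (rule bsum_cong) (simp add: g)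
  then show ?thesis using bsum_psum[of "map g P"] by simp
qed

section \<open>The axioms for lists of summands\<close>

lemma inj_on_fst_nth: "distinct (map fst P) \<Longrightarrow> inj_on (\<lambda>i. fst (P ! i)) {..<length P}"
  by (auto simp: inj_on_def distinct_conv_nth)

text \<open>RS has the shape \<open>t \<approx> t \<oplus> s\<close>, so it is literally an instance
  of \<open>\<preceq>\<close>.\<close>

lemma RS_below: "a \<cdot> (b \<cdot> x \<oplus> z) \<preceq> a \<cdot> (b \<cdot> x \<oplus> b \<cdot> y \<oplus> z)"
proof -
  have "(a \<cdot> (b \<cdot> X \<oplus> b \<cdot> Y \<oplus> Z), a \<cdot> (b \<cdot> X \<oplus> b \<cdot> Y \<oplus> Z) \<oplus> a \<cdot> (b \<cdot> X \<oplus> Z)) \<in> ERS"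
    by (auto simp: ERS_def RS_def)
  from derivable.inst[OF this, of "env [x, y, z]"] show ?thesis
    by (simp add: env_def below_def)
qed

lemma RSP1:
  "(a \<cdot> x \<oplus> a \<cdot> y \<oplus> u) \<parallel> (b \<cdot> z \<oplus> b \<cdot> w \<oplus> v)
   \<simeq> (a \<cdot> x \<oplus> u) \<parallel> (b \<cdot> z \<oplus> b \<cdot> w \<oplus> v) \<oplus> (a \<cdot> y \<oplus> u) \<parallel> (b \<cdot> z \<oplus> b \<cdot> w \<oplus> v)
     \<oplus> (a \<cdot> x \<oplus> a \<cdot> y \<oplus> u) \<parallel> (b \<cdot> z \<oplus> v) \<oplus> (a \<cdot> x \<oplus> a \<cdot> y \<oplus> u) \<parallel> (b \<cdot> w \<oplus> v)"
proof -
  have "((a \<cdot> X \<oplus> a \<cdot> Y \<oplus> U) \<parallel> (b \<cdot> Z \<oplus> b \<cdot> W \<oplus> V),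
            (a \<cdot> X \<oplus> U) \<parallel> (b \<cdot> Z \<oplus> b \<cdot> W \<oplus> V)
            \<oplus> (a \<cdot> Y \<oplus> U) \<parallel> (b \<cdot> Z \<oplus> b \<cdot> W \<oplus> V)
            \<oplus> (a \<cdot> X \<oplus> a \<cdot> Y \<oplus> U) \<parallel> (b \<cdot> Z \<oplus> V)
            \<oplus> (a \<cdot> X \<oplus> a \<cdot> Y \<oplus> U) \<parallel> (b \<cdot> W \<oplus> V)) \<in> ERS"
    by (auto simp: ERS_def RSP1_def)
  from derivable.inst[OF this, of "env [x, y, z, u, v, w]"] show ?thesis
    by (simp add: env_def)
qed

lemma RSP2:
  assumes "distinct (map fst P)"
  shows "psum P \<parallel> (b \<cdot> y \<oplus> b \<cdot> z \<oplus> w)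
   \<simeq> psum P \<parallel> (b \<cdot> y \<oplus> w) \<oplus> psum P \<parallel> (b \<cdot> z \<oplus> w) \<oplus> psum (parL_summands P (b \<cdot> y \<oplus> b \<cdot> z \<oplus> w))"
proof -
  let ?n = "length P" and ?a = "\<lambda>i. fst (P ! i)" and ?q = "b \<cdot> y \<oplus> b \<cdot> z \<oplus> w"
  \<comment> \<open>The entries \<open>y\<close>, \<open>z\<close>, \<open>w\<close> sit at the
    numbers of \<open>Y\<close>, \<open>Z\<close>, \<open>W\<close>; the zeros fill the places of
    \<open>X\<close>, \<open>U\<close>, \<open>V\<close>, which do not occur in RSP2.\<close>
  let ?\<sigma> = "env2 [\<zero>, y, z, \<zero>, \<zero>, w] (map snd P) []"
  let ?S = "bsum ?n (\<lambda>i. ?a i \<cdot> snd (P ! i))"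
  have "(bsum ?n (\<lambda>i. ?a i \<cdot> XI i) \<parallel> (b \<cdot> Y \<oplus> b \<cdot> Z \<oplus> W),
            bsum ?n (\<lambda>i. ?a i \<cdot> XI i) \<parallel> (b \<cdot> Y \<oplus> W)
            \<oplus> bsum ?n (\<lambda>i. ?a i \<cdot> XI i) \<parallel> (b \<cdot> Z \<oplus> W)
            \<oplus> bsum ?n (\<lambda>i. ?a i \<cdot> (XI i \<parallel> (b \<cdot> Y \<oplus> b \<cdot> Z \<oplus> W)))) \<in> RSP2"
    unfolding RSP2_def using inj_on_fst_nth[OF assms]
    by (intro CollectI exI[of _ ?n] exI[of _ ?a] exI[of _ b]) simp
  then have ax: "(bsum ?n (\<lambda>i. ?a i \<cdot> XI i) \<parallel> (b \<cdot> Y \<oplus> b \<cdot> Z \<oplus> W),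
            bsum ?n (\<lambda>i. ?a i \<cdot> XI i) \<parallel> (b \<cdot> Y \<oplus> W)
            \<oplus> bsum ?n (\<lambda>i. ?a i \<cdot> XI i) \<parallel> (b \<cdot> Z \<oplus> W)
            \<oplus> bsum ?n (\<lambda>i. ?a i \<cdot> (XI i \<parallel> (b \<cdot> Y \<oplus> b \<cdot> Z \<oplus> W)))) \<in> ERS"
    by (simp add: ERS_def)
  \<comment> \<open>The two lookups agree only for indices within the list, hence the bounded
    congruence \<open>bsum_cong\<close>.\<close>
  have S: "bsum ?n (\<lambda>i. ?a i \<cdot> map snd P ! i) = ?S"
    and T: "bsum ?n (\<lambda>i. ?a i \<cdot> (map snd P ! i \<parallel> ?q)) = bsum ?n (\<lambda>i. ?a i \<cdot> (snd (P ! i) \<parallel> ?q))"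
    by (rule bsum_cong; simp)+
  have "?S \<parallel> ?q \<simeq> ?S \<parallel> (b \<cdot> y \<oplus> w) \<oplus> ?S \<parallel> (b \<cdot> z \<oplus> w)
      \<oplus> bsum ?n (\<lambda>i. ?a i \<cdot> (snd (P ! i) \<parallel> ?q))"
    using derivable.inst[OF ax, of ?\<sigma>] by (simp add: bsum_subst env2_def S T)
  also have "\<dots> \<simeq> psum P \<parallel> (b \<cdot> y \<oplus> w) \<oplus> psum P \<parallel> (b \<cdot> z \<oplus> w) \<oplus> psum (parL_summands P ?q)"
    by (intro plus_cong par_cong bsum_psum derivable.refl bsum_map) simp
  finally show ?thesis
    using eq_trans[OF par_cong[OF eq_sym[OF bsum_psum] derivable.refl]] by blast
qed

lemma EL2:
  assumes "distinct (map fst P)" "distinct (map fst Q)"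
  shows "psum P \<parallel> psum Q \<simeq> psum (parL_summands P (psum Q)) \<oplus> psum (parR_summands (psum P) Q)"
proof -
  let ?n = "length P" and ?a = "\<lambda>i. fst (P ! i)" and ?m = "length Q" and ?b = "\<lambda>i. fst (Q ! i)"
  let ?\<sigma> = "env2 [] (map snd P) (map snd Q)"
  let ?S = "bsum ?n (\<lambda>i. ?a i \<cdot> snd (P ! i))" and ?T = "bsum ?m (\<lambda>i. ?b i \<cdot> snd (Q ! i))"
  have "(bsum ?n (\<lambda>i. ?a i \<cdot> XI i) \<parallel> bsum ?m (\<lambda>j. ?b j \<cdot> YI j),
           bsum ?n (\<lambda>i. ?a i \<cdot> (XI i \<parallel> bsum ?m (\<lambda>j. ?b j \<cdot> YI j)))
           \<oplus> bsum ?m (\<lambda>j. ?b j \<cdot> (bsum ?n (\<lambda>i. ?a i \<cdot> XI i) \<parallel> YI j))) \<in> EL2"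
    unfolding EL2_def using inj_on_fst_nth[OF assms(1)] inj_on_fst_nth[OF assms(2)]
    by (intro CollectI exI[of _ ?n] exI[of _ ?a] exI[of _ ?m] exI[of _ ?b]) simp
  then have ax: "(bsum ?n (\<lambda>i. ?a i \<cdot> XI i) \<parallel> bsum ?m (\<lambda>j. ?b j \<cdot> YI j),
           bsum ?n (\<lambda>i. ?a i \<cdot> (XI i \<parallel> bsum ?m (\<lambda>j. ?b j \<cdot> YI j)))
           \<oplus> bsum ?m (\<lambda>j. ?b j \<cdot> (bsum ?n (\<lambda>i. ?a i \<cdot> XI i) \<parallel> YI j))) \<in> ERS"
    by (simp add: ERS_def)
  have S: "bsum ?n (\<lambda>i. ?a i \<cdot> map snd P ! i) = ?S" "bsum ?m (\<lambda>i. ?b i \<cdot> map snd Q ! i) = ?T"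
    and T: "bsum ?n (\<lambda>i. ?a i \<cdot> (map snd P ! i \<parallel> ?T)) = bsum ?n (\<lambda>i. ?a i \<cdot> (snd (P ! i) \<parallel> ?T))"
       "bsum ?m (\<lambda>i. ?b i \<cdot> (?S \<parallel> map snd Q ! i)) = bsum ?m (\<lambda>i. ?b i \<cdot> (?S \<parallel> snd (Q ! i)))"
    by (rule bsum_cong; simp)+
  have "?S \<parallel> ?T \<simeq> bsum ?n (\<lambda>i. ?a i \<cdot> (snd (P ! i) \<parallel> ?T)) \<oplus> bsum ?m (\<lambda>i. ?b i \<cdot> (?S \<parallel> snd (Q ! i)))"
    using derivable.inst[OF ax, of ?\<sigma>] by (simp add: bsum_subst env2_def S T)
  also have "\<dots> \<simeq> bsum ?n (\<lambda>i. ?a i \<cdot> (snd (P ! i) \<parallel> psum Q)) \<oplus> bsum ?m (\<lambda>i. ?b i \<cdot> (psum P \<parallel> snd (Q ! i)))"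
    by (intro plus_cong bsum_eq_cong derivable.pre par_cong bsum_psum derivable.refl)
  also have "\<dots> \<simeq> psum (parL_summands P (psum Q)) \<oplus> psum (parR_summands (psum P) Q)"
    by (intro plus_cong bsum_map) simp_all
  finally show ?thesis
    using eq_trans[OF par_cong[OF eq_sym[OF bsum_psum] eq_sym[OF bsum_psum]]] by blast
qed

text \<open>Each summand \<open>b \<cdot> y\<close> of \<open>L\<close> has a partner
  \<open>b \<cdot> x\<close> in \<open>P\<close>. Absorption puts a copy of the partner in front, RS
  introduces \<open>b \<cdot> y\<close> beside it, and absorption removes the copy again.\<close>

lemma RS_remove_summands:
  assumes "fst ` set L \<subseteq> fst ` set P"
  shows "a \<cdot> psum P \<preceq> a \<cdot> (psum L \<oplus> psum P)"
  using assms
proof (induction L)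
  case Nil
  show ?case
    unfolding psum.simps by (intro pre_cong_below absorb_eq zero_below)
next
  case (Cons s L)
  obtain b y where s: "s = (b, y)" by force
  from Cons.prems s obtain x where x: "(b, x) \<in> set P" by force
  let ?z = "psum L \<oplus> psum P"
  have "a \<cdot> psum P \<preceq> a \<cdot> ?z" using Cons by simp
  also have "a \<cdot> ?z \<preceq> a \<cdot> (b \<cdot> x \<oplus> ?z)"
    by (intro pre_cong_below absorb_eq below_plusR summand_below[OF x])
  also have "\<dots> \<preceq> a \<cdot> (b \<cdot> x \<oplus> b \<cdot> y \<oplus> ?z)" by (rule RS_below)
  also have "\<dots> \<preceq> a \<cdot> (psum (s # L) \<oplus> psum P)"
    using summand_below[OF x]
    by (intro pre_cong_below) (auto simp: s eq_iff_below below_plusR below_plusL summand_below)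
  finally show ?case .
qed

section \<open>Ready simulation as a coinductive predicate\<close>

text \<open>The largest ready simulation on all terms, open ones included, so that reflexivity,
  transitivity and congruence carry no closedness conditions.\<close>

coinductive rsle :: "'a bccsp \<Rightarrow> 'a bccsp \<Rightarrow> bool" where
  "(\<And>a p'. step p a p' \<Longrightarrow> \<exists>q'. step q a q' \<and> rsle p' q') \<Longrightarrow> initials p = initials q \<Longrightarrow> rsle p q"

lemma rsle_coinductI:
  assumes "Rel p q"
    and "\<And>p q a p'. Rel p q \<Longrightarrow> step p a p' \<Longrightarrow> \<exists>q'. step q a q' \<and> Rel p' q'"
    and "\<And>p q. Rel p q \<Longrightarrow> initials p = initials q"
  shows "rsle p q"
  using assms(1)
proof (rule rsle.coinduct[where X = Rel])
  fix p q
  assume "Rel p q"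
  then show "\<exists>p' q'. p = p' \<and> q = q' \<and>
      (\<forall>a s. step p' a s \<longrightarrow> (\<exists>t. step q' a t \<and> (Rel s t \<or> rsle s t))) \<and> initials p' = initials q'"
    using assms(2,3)[of p q] by simp meson
qed

lemma rs_le_imp_rsle:
  assumes "p \<sqsubseteq>\<^sub>R\<^sub>S q"
  shows "rsle p q"
proof -
  obtain R where R: "simulation R" "ready_simulation R" "(p, q) \<in> R"
    using assms by (auto simp: rs_le_def ready_simulation_def)
  show ?thesis
  proof (rule rsle_coinductI[of "\<lambda>p q. (p, q) \<in> R"])
    show "\<exists>q'. step q a q' \<and> (p', q') \<in> R" if "(p, q) \<in> R" "step p a p'" for p q a p'
      using R(1) that by (simp add: simulation_def)
    show "initials p = initials q" if "(p, q) \<in> R" for p q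
      using R(2) that by (simp add: ready_simulation_def)
  qed fact
qed

lemma rsle_stepE:
  assumes "rsle p q" "step p a p'"
  obtains q' where "step q a q'" "rsle p' q'"
  using assms(1)
proof cases
  case 1
  then show thesis using assms(2) that by blast
qed

lemma rsle_initials: "rsle p q \<Longrightarrow> initials p = initials q"
  by (auto elim: rsle.cases)

lemma rsle_refl [simp]: "rsle p p"
  by (coinduction arbitrary: p) auto

lemma rsle_trans:
  fixes p q r :: "'a bccsp"
  assumes "rsle p q" "rsle q r"
  shows "rsle p r"
proof (rule rsle_coinductI[of "\<lambda>p r. \<exists>q. rsle p q \<and> rsle q r"])
  show "\<exists>r'. step r a r' \<and> (\<exists>q'. rsle p' q' \<and> rsle q' r')"
    if "\<exists>q. rsle p q \<and> rsle q r" "step p a p'" for p r p' :: "'a bccsp" and a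
    using that by (metis rsle_stepE)
  show "initials p = initials r" if "\<exists>q. rsle p q \<and> rsle q r" for p r :: "'a bccsp"
    using that rsle_initials by metis
qed (use assms in blast)

text \<open>The pairs of parallel compositions with related factors form a ready simulation: a move
  changes one factor, and initials are the union of those of the factors.\<close>

lemma rsle_par:
  fixes p p' q q' :: "'a bccsp"
  assumes "rsle p p'" "rsle q q'"
  shows "rsle (p \<parallel> q) (p' \<parallel> q')"
proof -
  define Rel where "Rel t t' \<longleftrightarrow> (\<exists>p p' q q'. t = p \<parallel> q \<and> t' = p' \<parallel> q' \<and> rsle p p' \<and> rsle q q')"
    for t t' :: "'a bccsp"
  have Rel: "Rel (p \<parallel> q) (p' \<parallel> q')" if "rsle p p'" "rsle q q'" for p p' q q' :: "'a bccsp"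
    using that by (auto simp: Rel_def)
  show ?thesis
  proof (rule rsle_coinductI[of Rel])
    fix t t' a s
    assume "Rel t t'" and step: "step t a s"
    then obtain p p' q q' where t: "t = p \<parallel> q" "t' = p' \<parallel> q'" and rsle: "rsle p p'" "rsle q q'"
      by (auto simp: Rel_def)
    consider u where "step p a u" "s = u \<parallel> q" | u where "step q a u" "s = p \<parallel> u"
      using step by (auto simp: t step_par_iff)
    then show "\<exists>s'. step t' a s' \<and> Rel s s'"
    proof cases
      case (1 u)
      then show ?thesis
        using rsle_stepE[OF rsle(1)] Rel[OF _ rsle(2)] step.parL[of p' a _ q'] by (metis t(2))
    next
      case (2 u)
      then show ?thesis
        using rsle_stepE[OF rsle(2)] Rel[OF rsle(1)] step.parR[of q' a _ p'] by (metis t(2))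
    qed
  next
    fix t t'
    assume "Rel t t'"
    then show "initials t = initials t'"
      by (auto simp: Rel_def dest!: rsle_initials)
  qed (intro Rel assms)
qed

lemma rsle_par_comm: "rsle (p \<parallel> q) (q \<parallel> p)"
  by (coinduction arbitrary: p q) (auto simp: step_par_iff)

lemma rsle_plus:
  assumes "rsle p p'" "rsle q q'"
  shows "rsle (p \<oplus> q) (p' \<oplus> q')"
proof (rule rsle.intros)
  show "\<exists>t'. step (p' \<oplus> q') a t' \<and> rsle t t'" if "step (p \<oplus> q) a t" for a t
    using that rsle_stepE[OF assms(1)] rsle_stepE[OF assms(2)] by (metis step_simps(4))
  show "initials (p \<oplus> q) = initials (p' \<oplus> q')"
    using assms by (simp add: rsle_initials[of p p'] rsle_initials[of q q'])
qed

text \<open>Only \<open>p\<close> must have all initials of \<open>r\<close>: the last summand of RSP2 lacks those of the right factor.\<close>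
lemma rsle_plus_le:
  assumes "rsle p r" "\<And>a q'. step q a q' \<Longrightarrow> \<exists>r'. step r a r' \<and> rsle q' r'"
  shows "rsle (p \<oplus> q) r"
proof (rule rsle.intros)
  show "\<exists>r'. step r a r' \<and> rsle t r'" if "step (p \<oplus> q) a t" for a t
    using that rsle_stepE[OF assms(1)] assms(2) by (metis step_simps(4))
  have "initials q \<subseteq> initials r"
    using assms(2) by (force simp: initials_def)
  then show "initials (p \<oplus> q) = initials r"
    using assms(1) by (auto simp: rsle_initials[of p r])
qed

lemma rsle_plus_lub: "rsle p r \<Longrightarrow> rsle q r \<Longrightarrow> rsle (p \<oplus> q) r"
  by (rule rsle_plus_le) (auto elim: rsle_stepE)

text \<open>Dropping summands is harmless for ready simulation as long as every action keeps a
  representative. This justifies the smaller factors on the right of RSP1 and RSP2.\<close>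

lemma rsle_psum_subset: "set P \<subseteq> set Q \<Longrightarrow> fst ` set P = fst ` set Q \<Longrightarrow> rsle (psum P) (psum Q)"
  by (rule rsle.intros) (auto simp: initials_psum intro: rsle_refl)

section \<open>Head normal forms\<close>

text \<open>Only the head is normalised; continuations are arbitrary. The clause with
  \<open>rsle\<close> carries along the half of soundness used later, and the clause on variables
  keeps the continuations of closed terms closed.\<close>

definition has_hnf :: "'a bccsp \<Rightarrow> bool" where
  "has_hnf t \<longleftrightarrow> (\<exists>R. t \<simeq> psum R \<and> rsle (psum R) t \<and> vars (psum R) \<subseteq> vars t)"

lemma has_hnf_psum: "has_hnf (psum P)"
  unfolding has_hnf_def using derivable.refl rsle_refl by blast

lemma has_hnf_mono:
  assumes "has_hnf u" "t \<simeq> u" "rsle u t" "vars u \<subseteq> vars t"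
  shows "has_hnf t"
  using assms unfolding has_hnf_def by (meson derivable.trans rsle_trans subset_trans)

lemma psum_append: "psum (P @ Q) \<simeq> psum P \<oplus> psum Q"
  by (auto simp: eq_iff_below intro: summand_below below_plusL below_plusR)

lemma has_hnf_plus:
  assumes "has_hnf t" "has_hnf u"
  shows "has_hnf (t \<oplus> u)"
proof -
  obtain P Q where P: "t \<simeq> psum P" "rsle (psum P) t" "vars (psum P) \<subseteq> vars t"
    and Q: "u \<simeq> psum Q" "rsle (psum Q) u" "vars (psum Q) \<subseteq> vars u"
    using assms unfolding has_hnf_def by blast
  have "rsle (psum (P @ Q)) (psum P \<oplus> psum Q)"
    by (rule rsle.intros) (auto simp: initials_psum intro: rsle_refl)
  then have "rsle (psum (P @ Q)) (t \<oplus> u)"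
    using rsle_plus[OF P(2) Q(2)] rsle_trans by blast
  moreover have "t \<oplus> u \<simeq> psum (P @ Q)"
    using eq_trans[OF plus_cong[OF P(1) Q(1)] eq_sym[OF psum_append]] .
  moreover have "vars (psum (P @ Q)) \<subseteq> vars (t \<oplus> u)"
    using P(3) Q(3) by (auto simp: vars_psum)
  ultimately show ?thesis
    unfolding has_hnf_def by blast
qed

section \<open>Expansion of parallel compositions of sums\<close>

text \<open>Two claims bundled for one induction, since the same axiom application yields both. The
  second mentions moves of the left factor only; P1 supplies the right ones in
  \<open>derivative_below\<close>.\<close>

definition expands :: "('a \<times> 'a bccsp) list \<Rightarrow> ('a \<times> 'a bccsp) list \<Rightarrow> bool" where
  "expands P Q \<longleftrightarrow> has_hnf (psum P \<parallel> psum Q) \<and>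
     (\<forall>(a, x) \<in> set P. a \<cdot> (x \<parallel> psum Q) \<preceq> psum P \<parallel> psum Q)"

lemma expands_set_cong:
  assumes "expands P Q" "set P = set P'" "set Q = set Q'"
  shows "expands P' Q'"
proof -
  have eq: "psum P' \<parallel> psum Q' \<simeq> psum P \<parallel> psum Q"
    using assms by (intro par_cong psum_set_cong) auto
  have "has_hnf (psum P' \<parallel> psum Q')"
    using assms(1) has_hnf_mono[OF _ eq] rsle_par[OF rsle_psum_subset rsle_psum_subset, of P P' Q Q'] assms(2,3)
    by (auto simp: expands_def vars_psum)
  moreover have "a \<cdot> (x \<parallel> psum Q') \<preceq> psum P' \<parallel> psum Q'" if "(a, x) \<in> set P'" for a x
  proof -
    have "a \<cdot> (x \<parallel> psum Q') \<preceq> a \<cdot> (x \<parallel> psum Q)"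
      using assms by (intro pre_cong_below par_cong derivable.refl psum_set_cong) auto
    also have "\<dots> \<preceq> psum P \<parallel> psum Q"
      using assms that by (auto simp: expands_def)
    also have "\<dots> \<preceq> psum P' \<parallel> psum Q'"
      using eq by (simp add: eq_iff_below)
    finally show ?thesis .
  qed
  ultimately show ?thesis by (auto simp: expands_def)
qed

text \<open>Agreement of sets suffices by \<open>expands_set_cong\<close>; the exact length is
  recorded because it is the induction measure of \<open>expands\<close>.\<close>

lemma not_distinct_fstE:
  assumes "\<not> distinct (map fst P)"
  obtains a x y R where "set P = set ((a, x) # (a, y) # R)" "length P = Suc (Suc (length R))"
proof -
  obtain xs ys zs a where "map fst P = xs @ [a] @ ys @ [a] @ zs"
    using not_distinct_decomp[OF assms] by blast
  then obtain P1 P2 P3 x y where "P = P1 @ (a, x) # P2 @ (a, y) # P3"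
    by (auto simp: map_eq_append_conv append_eq_map_conv Cons_eq_map_conv map_eq_Cons_conv)
  then show thesis
    by (intro that[of a x y "P1 @ P2 @ P3"]) auto
qed

text \<open>\<open>psum\<close> associates to the right and the axiom to the left; A2 reconciles
  them.\<close>

lemma RSP1_psum:
  fixes P' Q' :: "('a \<times> 'a bccsp) list" and a b x y z w
  defines "P \<equiv> (a, x) # (a, y) # P'" and "Q \<equiv> (b, z) # (b, w) # Q'"
  shows "psum P \<parallel> psum Q \<simeq> psum ((a, x) # P') \<parallel> psum Q \<oplus> psum ((a, y) # P') \<parallel> psum Q
    \<oplus> psum P \<parallel> psum ((b, z) # Q') \<oplus> psum P \<parallel> psum ((b, w) # Q')"
proof -
  let ?p = "a \<cdot> x \<oplus> a \<cdot> y \<oplus> psum P'" and ?q = "b \<cdot> z \<oplus> b \<cdot> w \<oplus> psum Q'"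
  have P: "psum P \<simeq> ?p" and Q: "psum Q \<simeq> ?q"
    using eq_sym[OF A2] by (simp_all add: P_def Q_def)
  have "psum P \<parallel> psum Q \<simeq> ?p \<parallel> ?q" by (rule par_cong[OF P Q])
  also have "\<dots> \<simeq> (a \<cdot> x \<oplus> psum P') \<parallel> ?q \<oplus> (a \<cdot> y \<oplus> psum P') \<parallel> ?q
      \<oplus> ?p \<parallel> (b \<cdot> z \<oplus> psum Q') \<oplus> ?p \<parallel> (b \<cdot> w \<oplus> psum Q')"
    by (rule RSP1)
  also have "\<dots> \<simeq> (a \<cdot> x \<oplus> psum P') \<parallel> psum Q \<oplus> (a \<cdot> y \<oplus> psum P') \<parallel> psum Q
      \<oplus> psum P \<parallel> (b \<cdot> z \<oplus> psum Q') \<oplus> psum P \<parallel> (b \<cdot> w \<oplus> psum Q')"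
    by (intro plus_cong par_cong derivable.refl eq_sym[OF P] eq_sym[OF Q])
  finally show ?thesis by simp
qed

lemma RSP2_psum:
  fixes P Q' :: "('a \<times> 'a bccsp) list" and b y z
  defines "Q \<equiv> (b, y) # (b, z) # Q'"
  assumes "distinct (map fst P)"
  shows "psum P \<parallel> psum Q \<simeq> psum P \<parallel> psum ((b, y) # Q') \<oplus> psum P \<parallel> psum ((b, z) # Q')
    \<oplus> psum (parL_summands P (psum Q))"
proof -
  let ?q = "b \<cdot> y \<oplus> b \<cdot> z \<oplus> psum Q'"
  have Q: "psum Q \<simeq> ?q"
    using eq_sym[OF A2] by (simp add: Q_def)
  have "psum P \<parallel> psum Q \<simeq> psum P \<parallel> ?q" by (rule par_cong[OF derivable.refl Q])
  also have "\<dots> \<simeq> psum P \<parallel> (b \<cdot> y \<oplus> psum Q') \<oplus> psum P \<parallel> (b \<cdot> z \<oplus> psum Q')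
      \<oplus> psum (parL_summands P ?q)"
    by (rule RSP2) fact
  also have "psum (parL_summands P ?q) \<simeq> psum (parL_summands P (psum Q))"
  proof (induction P)
    case (Cons s P)
    then show ?case
      by (simp add: case_prod_beta) (intro plus_cong derivable.pre par_cong derivable.refl eq_sym[OF Q])
  qed (simp add: derivable.refl)
  then have "psum P \<parallel> (b \<cdot> y \<oplus> psum Q') \<oplus> psum P \<parallel> (b \<cdot> z \<oplus> psum Q') \<oplus> psum (parL_summands P ?q)
    \<simeq> psum P \<parallel> (b \<cdot> y \<oplus> psum Q') \<oplus> psum P \<parallel> (b \<cdot> z \<oplus> psum Q') \<oplus> psum (parL_summands P (psum Q))"
    by (rule plus_congR)
  finally show ?thesis by simp
qed

lemma has_hnf_par_comm: "has_hnf (t \<parallel> u) \<Longrightarrow> has_hnf (u \<parallel> t)"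
  by (rule has_hnf_mono[OF _ P1 rsle_par_comm]) auto

text \<open>The third summand of RSP2 already is a sum of prefixes, all of them moves of the left
  factor. The first two are ready simulated by the whole because dropping one of two
  \<open>b\<close>-summands keeps the initials.\<close>

lemma has_hnf_RSP2:
  fixes P Q' :: "('a \<times> 'a bccsp) list" and b y z
  defines "Q \<equiv> (b, y) # (b, z) # Q'"
  assumes "distinct (map fst P)"
    and hnf: "has_hnf (psum P \<parallel> psum ((b, y) # Q'))" "has_hnf (psum P \<parallel> psum ((b, z) # Q'))"
  shows "has_hnf (psum P \<parallel> psum Q)"
proof (rule has_hnf_mono)
  let ?s = "psum P \<parallel> psum ((b, y) # Q') \<oplus> psum P \<parallel> psum ((b, z) # Q')"
  show "has_hnf (?s \<oplus> psum (parL_summands P (psum Q)))"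
    by (intro has_hnf_plus hnf has_hnf_psum)
  show "psum P \<parallel> psum Q \<simeq> ?s \<oplus> psum (parL_summands P (psum Q))"
    unfolding Q_def by (rule RSP2_psum) fact
  have "rsle ?s (psum P \<parallel> psum Q)"
    by (intro rsle_plus_lub rsle_par rsle_refl rsle_psum_subset) (auto simp: Q_def)
  then show "rsle (?s \<oplus> psum (parL_summands P (psum Q))) (psum P \<parallel> psum Q)"
    by (rule rsle_plus_le) (auto simp: step_par_iff)
  show "vars (?s \<oplus> psum (parL_summands P (psum Q))) \<subseteq> vars (psum P \<parallel> psum Q)"
    by (auto simp: vars_psum Q_def)
qed

text \<open>Induction on the total number of summands. EL2 applies when neither factor repeats an
  action, RSP2 when exactly one does, RSP1 when both do; the last two lead to compositions with one
  summand less.\<close>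

lemma expands: "expands P Q"
proof (induction "length P + length Q" arbitrary: P Q rule: less_induct)
  case less
  consider (distinct) "distinct (map fst P)" "distinct (map fst Q)"
    | (right) "distinct (map fst P)" "\<not> distinct (map fst Q)"
    | (left) "\<not> distinct (map fst P)" "distinct (map fst Q)"
    | (both) "\<not> distinct (map fst P)" "\<not> distinct (map fst Q)" by blast
  then show ?case
  proof cases
    case distinct
    note EL2 = EL2[OF distinct]
    have "has_hnf (psum P \<parallel> psum Q)"
    proof (rule has_hnf_mono[OF _ EL2])
      show "rsle (psum (parL_summands P (psum Q)) \<oplus> psum (parR_summands (psum P) Q)) (psum P \<parallel> psum Q)"
        by (rule rsle.intros) (auto simp: step_par_iff initials_psum image_image case_prod_beta, (metis rsle_refl)+)
    qed (auto intro: has_hnf_plus has_hnf_psum simp: vars_psum)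
    moreover have "a \<cdot> (x \<parallel> psum Q) \<preceq> psum P \<parallel> psum Q" if "(a, x) \<in> set P" for a x
      using that by (intro below_trans[OF _ eq_imp_below[OF eq_sym[OF EL2]]] below_plusL summand_below) force
    ultimately show ?thesis by (auto simp: expands_def)
  next
    case right
    obtain b y z Q' where Q: "set Q = set ((b, y) # (b, z) # Q')" "length Q = Suc (Suc (length Q'))"
      using not_distinct_fstE[OF right(2)] by metis
    let ?Q = "(b, y) # (b, z) # Q'"
    have "has_hnf (psum P \<parallel> psum ?Q)"
      using less[of P "(b, y) # Q'"] less[of P "(b, z) # Q'"] right Q
      by (intro has_hnf_RSP2) (auto simp: expands_def)
    \<comment> \<open>The third summand of RSP2 lists exactly these moves.\<close>
    moreover have "a \<cdot> (x \<parallel> psum ?Q) \<preceq> psum P \<parallel> psum ?Q" if "(a, x) \<in> set P" for a x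
      using that
      by (intro below_trans[OF _ eq_imp_below[OF eq_sym[OF RSP2_psum[OF right(1)]]]] below_plusR summand_below) force
    ultimately have "expands P ?Q" by (auto simp: expands_def)
    then show ?thesis by (rule expands_set_cong) (simp_all add: Q)
  next
    case left
    obtain b y z P' where P: "set P = set ((b, y) # (b, z) # P')" "length P = Suc (Suc (length P'))"
      using not_distinct_fstE[OF left(1)] by metis
    let ?P = "(b, y) # (b, z) # P'"
    have 1: "expands ((b, y) # P') Q" and 2: "expands ((b, z) # P') Q"
      using less P by simp_all
    have "has_hnf (psum ?P \<parallel> psum Q)"
      using 1 2 left by (intro has_hnf_par_comm[OF has_hnf_RSP2]) (auto simp: expands_def intro: has_hnf_par_comm)
    \<comment> \<open>With the factors swapped, the third summand of RSP2 lists the moves of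
      \<open>Q\<close> instead. Each summand of \<open>?P\<close> survives in one of the two
      shortened lists, whose induction hypothesis applies.\<close>
    moreover have "a \<cdot> (x \<parallel> psum Q) \<preceq> psum ?P \<parallel> psum Q" if "(a, x) \<in> set ?P" for a x
    proof -
      have "a \<cdot> (x \<parallel> psum Q) \<preceq> psum ((b, y) # P') \<parallel> psum Q \<or> a \<cdot> (x \<parallel> psum Q) \<preceq> psum ((b, z) # P') \<parallel> psum Q"
        using that 1 2 by (auto simp: expands_def)
      then have "a \<cdot> (x \<parallel> psum Q) \<preceq> psum Q \<parallel> psum ((b, y) # P') \<or> a \<cdot> (x \<parallel> psum Q) \<preceq> psum Q \<parallel> psum ((b, z) # P')"
        using below_trans[OF _ eq_imp_below[OF P1]] by blast
      then have "a \<cdot> (x \<parallel> psum Q) \<preceq> psum Q \<parallel> psum ?P"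
        by (rule disjE) (rule below_trans[OF _ eq_imp_below[OF eq_sym[OF RSP2_psum[OF left(2)]]]],
          rule below_plusL, erule below_plusL below_plusR)+
      then show ?thesis using below_trans[OF _ eq_imp_below[OF P1]] by blast
    qed
    ultimately have "expands ?P Q" by (auto simp: expands_def)
    then show ?thesis by (rule expands_set_cong) (simp_all add: P)
  next
    case both
    obtain b y z P' where P: "set P = set ((b, y) # (b, z) # P')" "length P = Suc (Suc (length P'))"
      using not_distinct_fstE[OF both(1)] by metis
    obtain c v w Q' where Q: "set Q = set ((c, v) # (c, w) # Q')" "length Q = Suc (Suc (length Q'))"
      using not_distinct_fstE[OF both(2)] by metis
    let ?P = "(b, y) # (b, z) # P'" and ?Q = "(c, v) # (c, w) # Q'"
    let ?s1 = "psum ((b, y) # P') \<parallel> psum ?Q" and ?s2 = "psum ((b, z) # P') \<parallel> psum ?Q"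
    let ?s3 = "psum ?P \<parallel> psum ((c, v) # Q')" and ?s4 = "psum ?P \<parallel> psum ((c, w) # Q')"
    have 1: "expands ((b, y) # P') ?Q" and 2: "expands ((b, z) # P') ?Q"
      and 3: "expands ?P ((c, v) # Q')" and 4: "expands ?P ((c, w) # Q')"
      using less P Q by simp_all
    note RSP1 = RSP1_psum[of b y z P' c v w Q']
    have "has_hnf (psum ?P \<parallel> psum ?Q)"
    proof (rule has_hnf_mono[OF _ RSP1])
      show "has_hnf (?s1 \<oplus> ?s2 \<oplus> ?s3 \<oplus> ?s4)"
        using 1 2 3 4 by (intro has_hnf_plus) (simp_all only: expands_def)
      show "rsle (?s1 \<oplus> ?s2 \<oplus> ?s3 \<oplus> ?s4) (psum ?P \<parallel> psum ?Q)"
        by (intro rsle_plus_lub rsle_par rsle_refl rsle_psum_subset) auto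
    qed auto
    moreover have "a \<cdot> (x \<parallel> psum ?Q) \<preceq> psum ?P \<parallel> psum ?Q" if "(a, x) \<in> set ?P" for a x
    proof -
      \<comment> \<open>\<open>?s1\<close> and \<open>?s2\<close> keep the right factor whole, so
        their moves lead to \<open>x \<parallel> psum ?Q\<close> itself; in \<open>?s3\<close> and
        \<open>?s4\<close> the right factor has shrunk.\<close>
      have "a \<cdot> (x \<parallel> psum ?Q) \<preceq> ?s1 \<or> a \<cdot> (x \<parallel> psum ?Q) \<preceq> ?s2"
        using that 1 2 by (auto simp: expands_def)
      then show ?thesis
        by (rule disjE) (rule below_trans[OF _ eq_imp_below[OF eq_sym[OF RSP1]]],
          rule below_plusL, rule below_plusL, erule below_plusL below_plusR)+
    qed
    ultimately have "expands ?P ?Q" by (auto simp: expands_def)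
    then show ?thesis by (rule expands_set_cong) (simp_all add: P Q)
  qed
qed

text \<open>Closedness rules out variables. For a parallel composition, the factors are first
  replaced by their normal forms, to which \<open>expands\<close> applies.\<close>

lemma closed_has_hnf: "vars t = {} \<Longrightarrow> has_hnf t"
proof (induction t)
  case Zero
  show ?case using has_hnf_psum[of "[]"] by simp
next
  case (Pre a t)
  have "rsle (psum [(a, t)]) (a \<cdot> t)"
    by (rule rsle.intros) (auto simp: initials_def intro: rsle_refl)
  then show ?case
    by (intro has_hnf_mono[OF has_hnf_psum[of "[(a, t)]"]]) (auto intro: eq_sym A0)
next
  case (Par t u)
  then obtain P Q where P: "t \<simeq> psum P" "rsle (psum P) t" "vars (psum P) \<subseteq> vars t"
    and Q: "u \<simeq> psum Q" "rsle (psum Q) u" "vars (psum Q) \<subseteq> vars u"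
    unfolding has_hnf_def by auto
  have "has_hnf (psum P \<parallel> psum Q)"
    using expands[of P Q] by (simp add: expands_def)
  then show ?case
    by (rule has_hnf_mono) (use P Q in \<open>auto intro: par_cong rsle_par\<close>)
qed (auto intro: has_hnf_plus)

lemma closed_hnfE:
  assumes "vars t = {}"
  obtains P where "t \<simeq> psum P" "rsle (psum P) t" "\<And>a x. (a, x) \<in> set P \<Longrightarrow> vars x = {}"
  using closed_has_hnf[OF assms] assms unfolding has_hnf_def by (fastforce simp: vars_psum)

section \<open>Derivatives as provable summands\<close>

lemma vars_step: "step p a p' \<Longrightarrow> vars p' \<subseteq> vars p"
  by (induction rule: step.induct) auto

lemma size_step: "step p a p' \<Longrightarrow> size p' < size p"
  by (induction rule: step.induct) auto

lemma par_derivative_below: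
  assumes "vars p = {}" "vars q = {}" and p': "a \<cdot> p' \<preceq> p"
  shows "a \<cdot> (p' \<parallel> q) \<preceq> p \<parallel> q"
proof -
  obtain P Q where P: "p \<simeq> psum P" and Q: "q \<simeq> psum Q"
    using assms closed_hnfE by metis
  \<comment> \<open>The normal form of \<open>p\<close> need not list \<open>a \<cdot> p'\<close>
    literally. Since \<open>p\<close> absorbs it, it can be added as a summand, and
    \<open>expands\<close> then treats it as a move of the left factor.\<close>
  let ?P = "(a, p') # P"
  have p: "psum ?P \<simeq> p"
    using eq_trans[OF absorb_eq[OF p'] plus_congR[OF P]] by (auto intro: eq_sym)
  have "a \<cdot> (p' \<parallel> q) \<preceq> a \<cdot> (p' \<parallel> psum Q)"
    by (intro pre_cong_below par_cong derivable.refl Q)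
  also have "\<dots> \<preceq> psum ?P \<parallel> psum Q"
    using expands[of ?P Q] by (simp add: expands_def)
  also have "\<dots> \<preceq> p \<parallel> q"
    by (intro eq_imp_below par_cong p eq_sym[OF Q])
  finally show ?thesis .
qed

lemma derivative_below: "step p a p' \<Longrightarrow> vars p = {} \<Longrightarrow> a \<cdot> p' \<preceq> p"
proof (induction rule: step.induct)
  case (parR p a p' q)
  then have "a \<cdot> (p' \<parallel> q) \<preceq> p \<parallel> q" by (intro par_derivative_below) auto
  moreover have "a \<cdot> (q \<parallel> p') \<preceq> a \<cdot> (p' \<parallel> q)" by (intro pre_cong_below P1)
  moreover have "p \<parallel> q \<preceq> q \<parallel> p" by (intro eq_imp_below P1)
  ultimately show ?case using below_trans by blast
qed (auto intro: below_plusL below_plusR par_derivative_below)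

section \<open>Completeness\<close>

text \<open>Absorption gives \<open>a \<cdot> y \<approx> a \<cdot> (y \<oplus> x)\<close>. Equal
  initials provide every summand of \<open>y\<close> with a partner in \<open>x\<close>, so
  \<open>RS_remove_summands\<close> places \<open>a \<cdot> x\<close> below the latter.\<close>

lemma pre_below:
  assumes "vars x = {}" "vars y = {}" "initials x = initials y" "x \<preceq> y"
  shows "a \<cdot> x \<preceq> a \<cdot> y"
proof -
  obtain P L where P: "x \<simeq> psum P" "rsle (psum P) x" and L: "y \<simeq> psum L" "rsle (psum L) y"
    using assms closed_hnfE by metis
  \<comment> \<open>Normal forms have the initials of their terms, by their \<open>rsle\<close>
    clause.\<close>
  have "fst ` set L \<subseteq> fst ` set P"
    using rsle_initials[OF P(2)] rsle_initials[OF L(2)] assms(3) by (simp add: initials_psum)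
  have "a \<cdot> x \<preceq> a \<cdot> psum P" by (intro pre_cong_below P)
  also have "\<dots> \<preceq> a \<cdot> (psum L \<oplus> psum P)" by (rule RS_remove_summands) fact
  also have "\<dots> \<preceq> a \<cdot> (y \<oplus> x)" by (intro pre_cong_below plus_cong eq_sym[OF P(1)] eq_sym[OF L(1)])
  also have "\<dots> \<preceq> a \<cdot> y" using assms(4) by (intro pre_cong_below eq_sym[of y]) (simp add: below_def)
  finally show ?thesis .
qed

text \<open>The induction is on the size of \<open>q\<close>: its derivatives are proper transitions
  and hence smaller, whereas normalising \<open>p\<close> gives no bound on the size of the
  continuations \<open>x\<close>.\<close>

lemma rsle_imp_below: "rsle p q \<Longrightarrow> vars p = {} \<Longrightarrow> vars q = {} \<Longrightarrow> p \<preceq> q"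
proof (induction "size q" arbitrary: p q rule: less_induct)
  case less
  obtain P where P: "p \<simeq> psum P" "rsle (psum P) p" "\<And>a x. (a, x) \<in> set P \<Longrightarrow> vars x = {}"
    using closed_hnfE[OF less.prems(2)] by metis
  have "a \<cdot> x \<preceq> q" if ax: "(a, x) \<in> set P" for a x
  proof -
    obtain q' where q': "step q a q'" "rsle x q'"
      using rsle_stepE[OF rsle_trans[OF P(2) less.prems(1)]] ax by (metis step_psum)
    have closed: "vars x = {}" "vars q' = {}"
      using P(3)[OF ax] vars_step[OF q'(1)] less.prems(3) by auto
    have "x \<preceq> q'"
      by (rule less.hyps[OF size_step[OF q'(1)] q'(2) closed])
    then have "a \<cdot> x \<preceq> a \<cdot> q'"
      by (intro pre_below closed rsle_initials q'(2))
    also have "\<dots> \<preceq> q" by (rule derivative_below[OF q'(1) less.prems(3)])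
    finally show ?thesis .
  qed
  then have "psum P \<preceq> q" by auto
  then show ?case using below_trans[OF eq_imp_below[OF P(1)]] by blast
qed

theorem theorem3p6:
  fixes p q :: "'a::finite bccsp"
  assumes "p \<in> processes" and "q \<in> processes" and "p \<sim>\<^sub>R\<^sub>S q"
  shows "ERS \<turnstile> p \<approx> q"
  using assms unfolding eq_iff_below rs_equiv_def processes_def
  by (auto intro: rsle_imp_below rs_le_imp_rsle)

end
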